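(* Let $T_n(x)=\sum_{k=0}^{n-1}|c_n(k)|x^k$ for $n\ge 1$. (i) For every $n\ge 1$, $T_n(x)=\frac{n}{\gamma(n)}T_{\gamma(n)}\big(x^{n/\gamma(n)}\big)$. (ii) Let $n\ge 1$ and $p$ a prime. If $p\mid n$, then $T_{np}(x)=pT_n(x^p)$. If $p\nmid n$, then $T_{np}(x)=(p-2)T_n(x^p)+(1+x^n+x^{2n}+\cdots+x^{(p-1)n})T_n(x)$.
   Context: For integers $n\ge 1$ and $k$, the Ramanujan sum $c_n(k)$ is the sum of the $k$th powers of the primitive $n$th roots of unity, i.e. $c_n(k)=\sum_{1\le j\le n,\ \gcd(j,n)=1} e^{2\pi \sqrt{-1}\, jk/n}$. $\gamma(n)=\prod_{p\mid n}p$ is the product of the distinct primes dividing $n$. *)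

theory Defs
  imports "HOL-Analysis.Analysis" "HOL-Computational_Algebra.Computational_Algebra"
begin

definition ramanujan_sum :: "nat \<Rightarrow> int \<Rightarrow> complex" where
  "ramanujan_sum n k =
     (\<Sum>j | 1 \<le> j \<and> j \<le> n \<and> gcd j n = 1.
        exp (2 * of_real pi * \<i> * of_nat j * of_int k / of_nat n))"

definition squarefree_kernel :: "nat \<Rightarrow> nat" where
  "squarefree_kernel n = (\<Prod>p | prime p \<and> p dvd n. p)"

definition T_poly :: "nat \<Rightarrow> real poly" where
  "T_poly n = (\<Sum>k<n. monom (cmod (ramanujan_sum n (int k))) k)"

end

theory Submission
  imports Defs "HOL-Number_Theory.Cong"
begin

text \<open>
  Summing \<open>e(jk/(nm))\<close> over all \<open>j < nm\<close> coprime to \<open>n\<close> (rather than to \<open>nm\<close>) and writing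
  \<open>j = a + nb\<close> gives \<open>m c\<^sub>n(k/m)\<close> if \<open>m\<close> divides \<open>k\<close> and \<open>0\<close> otherwise. If every prime factor
  of \<open>m\<close> divides \<open>n\<close>, this sum is \<open>c\<^sub>n\<^sub>m(k)\<close>, which yields (i) and the first half of (ii).
  If \<open>m = p\<close> is a prime not dividing \<open>n\<close>, the sum exceeds \<open>c\<^sub>n\<^sub>p(k)\<close> by the terms with \<open>p\<close>
  dividing \<open>j\<close>, which add up to \<open>c\<^sub>n(k)\<close>; since \<open>c\<^sub>n(k/p) = c\<^sub>n(k)\<close>, the absolute value of
  \<open>c\<^sub>n\<^sub>p(k)\<close> is \<open>(p-1)|c\<^sub>n(k)|\<close> or \<open>|c\<^sub>n(k)|\<close> according to whether \<open>p\<close> divides \<open>k\<close>.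
\<close>

section \<open>Roots of unity and their power sums\<close>

definition root_exp :: "nat \<Rightarrow> nat \<Rightarrow> complex" where
  "root_exp n j = exp (2 * of_real pi * \<i> * of_nat j / of_nat n)"

lemma root_exp_add: "root_exp n (i + j) = root_exp n i * root_exp n j"
  by (simp add: root_exp_def exp_add [symmetric] add_divide_distrib [symmetric] ring_distribs)

lemma root_exp_power: "root_exp n (i * j) = root_exp n i ^ j"
  by (simp add: root_exp_def exp_of_nat_mult [symmetric] mult_ac)

lemma root_exp_self_mult: "root_exp n (n * j) = 1"
proof (cases "n = 0")
  case False
  have "root_exp n n = 1"
    using False by (simp add: root_exp_def)
  then show ?thesis
    by (simp add: root_exp_power)
\<comment> \<open>For \<open>n = 0\<close> division by zero yields 0, so the value is
  \<open>exp 0 = 1\<close>.\<close>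
qed (simp add: root_exp_def)

lemma root_exp_mod: "root_exp n (j mod n) = root_exp n j"
proof -
  have "root_exp n j = root_exp n (j mod n + n * (j div n))"
    by simp
  also have "\<dots> = root_exp n (j mod n)"
    by (simp only: root_exp_add root_exp_self_mult mult_1_right)
  finally show ?thesis ..
qed

lemma root_exp_mod_mult: "root_exp n (j mod n * k) = root_exp n (j * k)"
  by (metis mod_mult_left_eq root_exp_mod)

lemma root_exp_cancel: "m > 0 \<Longrightarrow> root_exp (n * m) (j * m) = root_exp n j"
  by (simp add: root_exp_def mult.assoc)

lemma root_exp_eq_1_iff:
  assumes "n > 0"
  shows "root_exp n j = 1 \<longleftrightarrow> n dvd j"
proof
  assume "root_exp n j = 1"
  then obtain k :: int where "2 * pi * real j / real n = of_int (2 * k) * pi"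
    unfolding root_exp_def exp_eq_1 by auto
  then have "real j = of_int k * real n"
    using assms by (simp add: field_simps)
  then have "real_of_int (int j) = of_int (k * int n)"
    by simp
  then have "int j = k * int n"
    by (simp only: of_int_eq_iff)
  then show "n dvd j"
    by (metis dvd_triv_right int_dvd_int_iff)
qed (auto simp: root_exp_self_mult)

text \<open>A geometric sum with ratio \<open>root_exp n k\<close>. The ratio is 1 exactly when
  \<open>n\<close> divides \<open>k\<close>; otherwise its \<open>n\<close>-th power is still 1, so
  the sum vanishes.\<close>

lemma sum_root_exp_mult:
  assumes "n > 0"
  shows "(\<Sum>b<n. root_exp n (b * k)) = (if n dvd k then of_nat n else 0)"
proof -
  have "(\<Sum>b<n. root_exp n (b * k)) = (\<Sum>b<n. root_exp n k ^ b)"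
    by (simp add: root_exp_power [symmetric] mult.commute)
  also have "\<dots> = (if n dvd k then of_nat n else 0)"
  proof (cases "n dvd k")
    case False
    then have "root_exp n k \<noteq> 1"
      using assms by (simp add: root_exp_eq_1_iff)
    moreover have "root_exp n k ^ n = 1"
      by (metis mult.commute root_exp_power root_exp_self_mult)
    ultimately show ?thesis
      using False by (simp add: sum_gp_strict)
  qed (use assms in \<open>auto simp: root_exp_self_mult\<close>)
  finally show ?thesis .
qed

text \<open>Sorts the indices by their residue \<open>a\<close> modulo \<open>n\<close>: the range
  is cut into \<open>m\<close> blocks of length \<open>n\<close>, and then the two sums are
  swapped.\<close>

lemma sum_lessThan_mult:
  fixes f :: "nat \<Rightarrow> 'a::comm_monoid_add"
  shows "(\<Sum>j<n * m. f j) = (\<Sum>a<n. \<Sum>b<m. f (a + n * b))"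
proof -
  have "(\<Sum>j<n * m. f j) = (\<Sum>b<m. sum f {b * n..<b * n + n})"
    by (simp add: sum.nat_group mult.commute)
  also have "\<dots> = (\<Sum>b<m. \<Sum>a<n. f (a + n * b))"
  proof (rule sum.cong)
    fix b
    show "sum f {b * n..<b * n + n} = (\<Sum>a<n. f (a + n * b))"
      using sum.shift_bounds_nat_ivl [of f 0 "b * n" n]
      by (simp add: atLeast0LessThan add.commute mult.commute)
  qed simp
  finally show ?thesis
    by (simp add: sum.swap [of _ "{..<m}"])
qed

section \<open>Evaluation of Ramanujan sums\<close>

text \<open>Moves the index range from 1..n to the residues 0..n-1. For \<open>n > 1\<close> neither
  0 nor \<open>n\<close> is coprime to \<open>n\<close>; for \<open>n = 1\<close> the index 1
  becomes 0, and both terms equal 1.\<close>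

lemma ramanujan_sum_altdef:
  assumes "n > 0"
  shows "ramanujan_sum n (int k) = (\<Sum>j | j < n \<and> coprime j n. root_exp n (j * k))"
proof (cases "n = 1")
  case True
  have "{j. 1 \<le> j \<and> j \<le> (1::nat) \<and> gcd j 1 = 1} = {1}"
    by auto
  then show ?thesis
    using True root_exp_self_mult [of 1 k] by (simp add: ramanujan_sum_def root_exp_def)
next
  case False
  have "{j. 1 \<le> j \<and> j \<le> n \<and> gcd j n = 1} = {j. j < n \<and> coprime j n}"
  proof (intro Collect_cong)
    fix j
    have "j \<noteq> 0" "j \<noteq> n" if "gcd j n = 1"
      using that False by (metis gcd_0_left_nat, metis gcd_idem_nat)
    then show "1 \<le> j \<and> j \<le> n \<and> gcd j n = 1 \<longleftrightarrow> j < n \<and> coprime j n"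
      by (auto simp: coprime_iff_gcd_eq_1 le_less)
  qed
  then show ?thesis
    by (simp add: ramanujan_sum_def root_exp_def mult_ac)
qed

lemma sum_root_exp_coprime:
  assumes "n > 0" "m > 0"
  shows "(\<Sum>j | j < n * m \<and> coprime j n. root_exp (n * m) (j * k)) =
           (if m dvd k then of_nat m * ramanujan_sum n (int (k div m)) else 0)"
proof -
  let ?e = "\<lambda>j. root_exp (n * m) (j * k)"
  have split: "?e (a + n * b) = ?e a * root_exp m (b * k)" for a b
    using root_exp_cancel [of n m "b * k"] assms
    by (simp add: root_exp_add ring_distribs mult_ac)
  have "(\<Sum>j | j < n * m \<and> coprime j n. ?e j) = (\<Sum>j<n * m. if coprime j n then ?e j else 0)"
    by (simp add: sum.inter_filter [symmetric] lessThan_def)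
  \<comment> \<open>Coprimality of \<open>a + n * b\<close> to \<open>n\<close> depends on
    \<open>a\<close> only, so \<open>b\<close> survives only in the factor
    \<open>root_exp m (b * k)\<close>.\<close>
  also have "\<dots> = (\<Sum>a<n. \<Sum>b<m. if coprime a n then ?e a * root_exp m (b * k) else 0)"
    unfolding sum_lessThan_mult split
    by (intro sum.cong refl if_cong)
       (metis coprime_iff_gcd_eq_1 gcd.commute gcd_add_mult mult.commute add.commute)
  also have "\<dots> = (\<Sum>a<n. if coprime a n then ?e a * (\<Sum>b<m. root_exp m (b * k)) else 0)"
    by (intro sum.cong) (auto simp: sum_distrib_left)
  also have "\<dots> = (\<Sum>a | a < n \<and> coprime a n. ?e a) * (if m dvd k then of_nat m else 0)"
    unfolding sum_root_exp_mult [OF assms(2)] sum_distrib_right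
    by (simp add: sum.inter_filter [symmetric] lessThan_def)
  also have "\<dots> = (if m dvd k then of_nat m * ramanujan_sum n (int (k div m)) else 0)"
  proof (cases "m dvd k")
    case True
    then obtain l where "k = l * m"
      by (metis dvdE mult.commute)
    then show ?thesis
      using assms root_exp_cancel [of m n]
      by (simp add: ramanujan_sum_altdef mult.assoc [symmetric])
  qed simp
  finally show ?thesis .
qed

text \<open>A prime dividing both \<open>j\<close> and \<open>m\<close> would also divide
  \<open>n\<close>, so being coprime to \<open>n * m\<close> is the same as being coprime to
  \<open>n\<close>.\<close>

lemma ramanujan_sum_mult_same_primes:
  assumes "n > 0" "m > 0" and primes: "\<And>q. prime q \<Longrightarrow> q dvd m \<Longrightarrow> q dvd n"
  shows "ramanujan_sum (n * m) (int k) =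
           (if m dvd k then of_nat m * ramanujan_sum n (int (k div m)) else 0)"
proof -
  have "coprime j (n * m) \<longleftrightarrow> coprime j n" for j
  proof
    assume *: "coprime j n"
    have "coprime j m"
    proof (rule ccontr)
      assume "\<not> coprime j m"
      then obtain q where "prime q" "q dvd j" "q dvd m"
        by (metis coprime_iff_gcd_eq_1 gcd_greatest_iff prime_factor_nat)
      with primes * show False
        by (metis coprime_common_divisor not_prime_unit)
    qed
    with * show "coprime j (n * m)"
      by simp
  qed simp
  then show ?thesis
    using assms sum_root_exp_coprime [of n m k] by (simp add: ramanujan_sum_altdef)
qed

text \<open>Multiplication by \<open>m\<close> permutes the units modulo \<open>n\<close>: it is an
  injective map of a finite set into itself, and the sum is reindexed along it.\<close>

lemma ramanujan_sum_mult_coprime_arg: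
  assumes "n > 0" "coprime m n"
  shows "ramanujan_sum n (int (m * k)) = ramanujan_sum n (int k)"
proof -
  let ?A = "{j. j < n \<and> coprime j n}"
  let ?f = "\<lambda>j. j * m mod n"
  have inj: "inj_on ?f ?A"
  proof (rule inj_onI)
    fix i j assume *: "i \<in> ?A" "j \<in> ?A" and "i * m mod n = j * m mod n"
    then have "[i * m = j * m] (mod n)"
      by (simp add: unique_euclidean_semiring_class.cong_def)
    then have "[i = j] (mod n)"
      using assms by (simp add: cong_mult_rcancel_nat)
    then show "i = j"
      using * by (simp add: unique_euclidean_semiring_class.cong_def)
  qed
  have "?f ` ?A \<subseteq> ?A"
    using assms by (auto simp: coprime_iff_gcd_eq_1 [symmetric])
  then have image: "?f ` ?A = ?A"
    using inj by (simp add: endo_inj_surj)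
  have "ramanujan_sum n (int k) = (\<Sum>j\<in>?f ` ?A. root_exp n (j * k))"
    unfolding image using assms(1) by (rule ramanujan_sum_altdef)
  also have "\<dots> = (\<Sum>j\<in>?A. root_exp n (j * (m * k)))"
    using inj by (simp add: sum.reindex root_exp_mod_mult mult.assoc)
  also have "\<dots> = ramanujan_sum n (int (m * k))"
    using assms(1) by (rule ramanujan_sum_altdef [symmetric])
  finally show ?thesis ..
qed

lemma ramanujan_sum_mult_prime:
  assumes "n > 0" "prime p" "\<not> p dvd n"
  shows "ramanujan_sum (n * p) (int k) =
           (if p dvd k then of_nat p - 1 else - 1) * ramanujan_sum n (int k)"
proof -
  let ?e = "\<lambda>j. root_exp (n * p) (j * k)"
  let ?B = "{j. j < n * p \<and> coprime j (n * p)}"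
  let ?A = "{j. j < n \<and> coprime j n}"
  have p: "p > 0" "coprime p n"
    using assms by (auto simp: prime_gt_0_nat prime_imp_coprime)
  have coprime_p: "coprime j p \<longleftrightarrow> \<not> p dvd j" for j
    using assms(2) by (metis coprime_commute coprime_absorb_left not_prime_unit prime_imp_coprime)
  \<comment> \<open>Split by whether \<open>p\<close> divides \<open>j\<close>; as \<open>p\<close>
    is coprime to \<open>n\<close>, the multiples of \<open>p\<close> are the \<open>i * p\<close>
    with \<open>i\<close> a unit modulo \<open>n\<close>.\<close>
  have union: "{j. j < n * p \<and> coprime j n} = ?B \<union> (\<lambda>i. i * p) ` ?A"
  proof (intro equalityI subsetI)
    fix j assume j: "j \<in> {j. j < n * p \<and> coprime j n}"
    show "j \<in> ?B \<union> (\<lambda>i. i * p) ` ?A"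
    proof (cases "p dvd j")
      case True
      then obtain i where "j = i * p"
        by (metis dvdE mult.commute)
      with j show ?thesis
        by auto
    qed (use j coprime_p in auto)
  qed (use p in auto)
  have disjoint: "?B \<inter> (\<lambda>i. i * p) ` ?A = {}"
    using not_prime_unit [of p] assms(2) by (auto simp: coprime_mult_right_iff coprime_mult_left_iff)
  have "(\<Sum>j | j < n * p \<and> coprime j n. ?e j) = sum ?e ?B + sum ?e ((\<lambda>i. i * p) ` ?A)"
    unfolding union by (rule sum.union_disjoint) (use disjoint in auto)
  also have "sum ?e ?B = ramanujan_sum (n * p) (int k)"
    using assms(1) p by (simp add: ramanujan_sum_altdef)
  also have "sum ?e ((\<lambda>i. i * p) ` ?A) = (\<Sum>i\<in>?A. root_exp (n * p) (i * k * p))"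
    using p by (subst sum.reindex) (auto simp: inj_on_def mult_ac)
  also have "\<dots> = ramanujan_sum n (int k)"
    using assms(1) p by (simp add: ramanujan_sum_altdef root_exp_cancel)
  finally have "ramanujan_sum (n * p) (int k) =
      (if p dvd k then of_nat p * ramanujan_sum n (int (k div p)) else 0) - ramanujan_sum n (int k)"
    using sum_root_exp_coprime [OF assms(1) p(1), of k] by (simp add: algebra_simps)
  moreover have "ramanujan_sum n (int (k div p)) = ramanujan_sum n (int k)" if "p dvd k"
    using ramanujan_sum_mult_coprime_arg [OF assms(1) p(2), of "k div p"] that by simp
  ultimately show ?thesis
    by (simp add: left_diff_distrib)
qed

lemma ramanujan_sum_mod:
  assumes "n > 0"
  shows "ramanujan_sum n (int (k mod n)) = ramanujan_sum n (int k)"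
  using assms by (simp only: ramanujan_sum_altdef) (metis mult.commute root_exp_mod_mult)

section \<open>Coefficient comparison for the polynomials \<open>T_poly\<close>\<close>

lemma pcompose_monom_monom:
  fixes c :: "'a::comm_semiring_1"
  shows "pcompose (monom c k) (monom 1 m) = monom c (k * m)"
  by (induction k) (simp_all add: monom_Suc monom_0 pcompose_pCons mult_monom add.commute)

text \<open>Pads the substituted polynomial with zero coefficients, so that it runs over the same
  exponents as \<open>T_poly (n * m)\<close> and can be compared with it term by term.\<close>

lemma pcompose_T_poly_monom:
  assumes "m > 0"
  shows "pcompose (T_poly n) (monom 1 m) =
    (\<Sum>k<n * m. monom (if m dvd k then cmod (ramanujan_sum n (int (k div m))) else 0) k)"
    (is "_ = (\<Sum>k<_. ?g k)")
proof -
  have "(\<Sum>k<m * n. ?g k) = (\<Sum>a<m. \<Sum>b<n. ?g (a + m * b))"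
    by (rule sum_lessThan_mult)
  \<comment> \<open>Among the residues \<open>a < m\<close>, only \<open>a = 0\<close> makes
    \<open>a + m * b\<close> divisible by \<open>m\<close>.\<close>
  also have "\<dots> = (\<Sum>a<m. if a = 0 then \<Sum>b<n. ?g (m * b) else 0)"
    by (intro sum.cong) (auto intro!: sum.neutral dest: nat_dvd_not_less simp: dvd_add_left_iff)
  also have "\<dots> = pcompose (T_poly n) (monom 1 m)"
    using assms by (simp add: T_poly_def pcompose_sum pcompose_monom_monom mult.commute)
  finally show ?thesis
    by (simp add: mult.commute)
qed

lemma smult_sum_right: "smult c (\<Sum>i\<in>A. f i) = (\<Sum>i\<in>A. smult c (f i))"
  by (induction A rule: infinite_finite_induct) (simp_all add: smult_add_right)

lemma T_poly_mult_same_primes: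
  assumes "n > 0" "m > 0" and "\<And>q. prime q \<Longrightarrow> q dvd m \<Longrightarrow> q dvd n"
  shows "T_poly (n * m) = smult (real m) (pcompose (T_poly n) (monom 1 m))"
  unfolding pcompose_T_poly_monom [OF assms(2)] T_poly_def [of "n * m"] smult_sum_right
  by (intro sum.cong refl)
     (simp add: ramanujan_sum_mult_same_primes [OF assms] smult_monom norm_mult)

text \<open>The coefficients have period \<open>n\<close> in \<open>k\<close>, so \<open>p\<close>
  shifted copies of \<open>T_poly n\<close> continue the same sequence up to
  \<open>n * p\<close>.\<close>

lemma sum_monom_mult_T_poly:
  assumes "n > 0"
  shows "(\<Sum>i<p. monom 1 (i * n)) * T_poly n =
           (\<Sum>k<n * p. monom (cmod (ramanujan_sum n (int k))) k)"
proof -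
  have "(\<Sum>k<n * p. monom (cmod (ramanujan_sum n (int k))) k) =
        (\<Sum>a<n. \<Sum>b<p. monom (cmod (ramanujan_sum n (int ((a + n * b) mod n)))) (a + n * b))"
    unfolding sum_lessThan_mult ramanujan_sum_mod [OF assms] ..
  also have "\<dots> = (\<Sum>a<n. \<Sum>b<p. monom (cmod (ramanujan_sum n (int a))) (a + n * b))"
    by (intro sum.cong) simp_all
  also have "\<dots> = (\<Sum>i<p. monom 1 (i * n)) * T_poly n"
    by (subst sum.swap) (simp add: T_poly_def sum_product mult_monom add.commute mult.commute)
  finally show ?thesis ..
qed

lemma T_poly_mult_prime:
  assumes "n > 0" "prime p" "\<not> p dvd n"
  shows "T_poly (n * p) = smult (real p - 2) (pcompose (T_poly n) (monom 1 p)) +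
           (\<Sum>i<p. monom 1 (i * n)) * T_poly n"
proof -
  have p: "p > 0" "coprime p n"
    using assms by (auto simp: prime_gt_0_nat prime_imp_coprime)
  have div: "ramanujan_sum n (int (k div p)) = ramanujan_sum n (int k)" if "p dvd k" for k
    using ramanujan_sum_mult_coprime_arg [OF assms(1) p(2), of "k div p"] that by simp
  have "cmod (of_nat p - 1) = real p - 1"
    using p by (metis One_nat_def Suc_leI norm_of_nat of_nat_1 of_nat_diff)
  \<comment> \<open>The factor is \<open>p - 1 = (p - 2) + 1\<close> if \<open>p\<close> divides
    \<open>k\<close>, and 1 otherwise: every exponent receives 1, and the multiples of
    \<open>p\<close> a further \<open>p - 2\<close>.\<close>
  then have "monom (cmod (ramanujan_sum (n * p) (int k))) k =
      smult (real p - 2)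
        (monom (if p dvd k then cmod (ramanujan_sum n (int (k div p))) else 0) k) +
      monom (cmod (ramanujan_sum n (int k))) k" for k
    by (auto simp: ramanujan_sum_mult_prime [OF assms] div norm_mult smult_monom add_monom
        ring_distribs)
  then show ?thesis
    unfolding sum_monom_mult_T_poly [OF assms(1)] pcompose_T_poly_monom [OF p(1)]
      T_poly_def [of "n * p"] smult_sum_right sum.distrib [symmetric]
    by (intro sum.cong refl)
qed

text \<open>Distinct primes are coprime, so their divisibilities of \<open>n\<close> combine one by
  one.\<close>

lemma prod_primes_dvd:
  fixes n :: nat
  assumes "finite A" "\<And>p. p \<in> A \<Longrightarrow> prime p \<and> p dvd n"
  shows "\<Prod>A dvd n"
  using assms
proof (induction A rule: finite_induct)
  case (insert p A)
  have "coprime p (\<Prod>A)"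
    using insert by (intro prod_coprime_right) (metis insertCI primes_coprime)
  then show ?case
    using insert by (simp add: divides_mult)
qed simp

lemma squarefree_kernel_dvd: "n > 0 \<Longrightarrow> squarefree_kernel n dvd n"
  unfolding squarefree_kernel_def by (rule prod_primes_dvd) auto

lemma prime_dvd_squarefree_kernel:
  assumes "n > 0" "prime q" "q dvd n"
  shows "q dvd squarefree_kernel n"
proof -
  have "finite {p. prime p \<and> p dvd n}"
    using assms(1) by simp
  then show ?thesis
    unfolding squarefree_kernel_def using assms dvd_prodI [of _ q "\<lambda>p. p"] by simp
qed

theorem theorem13:
  "(\<forall>n::nat. n \<ge> 1 \<longrightarrow>
      T_poly n =
        smult (real n / real (squarefree_kernel n))
          (pcompose (T_poly (squarefree_kernel n)) (monom 1 (n div squarefree_kernel n)))) \<and>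
   (\<forall>(n::nat) (p::nat). n \<ge> 1 \<and> prime p \<longrightarrow>
      (p dvd n \<longrightarrow>
         T_poly (n * p) = smult (real p) (pcompose (T_poly n) (monom 1 p))) \<and>
      (\<not> p dvd n \<longrightarrow>
         T_poly (n * p) =
           smult (real p - 2) (pcompose (T_poly n) (monom 1 p)) +
           (\<Sum>i<p. monom 1 (i * n)) * T_poly n))"
proof (intro conjI allI impI; (elim conjE)?)
  fix n :: nat assume "n \<ge> 1"
  let ?g = "squarefree_kernel n"
  obtain m where m: "n = ?g * m"
    using squarefree_kernel_dvd \<open>n \<ge> 1\<close> by (metis dvdE less_eq_Suc_le One_nat_def)
  then have pos: "?g > 0" "m > 0"
    using \<open>n \<ge> 1\<close> by (metis gr0I mult_0 mult_0_right not_one_le_zero)+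
  \<comment> \<open>Prime factors of the cofactor \<open>m\<close> divide \<open>n\<close>, hence
    its kernel, so the same-primes case applies with \<open>?g\<close> as the base.\<close>
  have "q dvd ?g" if "prime q" "q dvd m" for q
    using prime_dvd_squarefree_kernel [of n q] that \<open>n \<ge> 1\<close> m by (metis One_nat_def Suc_le_eq dvd_mult)
  then have "T_poly (?g * m) = smult (real m) (pcompose (T_poly ?g) (monom 1 m))"
    using pos by (intro T_poly_mult_same_primes)
  moreover have "n div ?g = m" "real n / real ?g = real m"
    using m pos by (metis nonzero_mult_div_cancel_left less_numeral_extra(3),
      metis nonzero_mult_div_cancel_left of_nat_mult of_nat_0_eq_iff less_numeral_extra(3))
  ultimately show "T_poly n = smult (real n / real ?g) (pcompose (T_poly ?g) (monom 1 (n div ?g)))"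
    using m by simp
next
  fix n p :: nat assume "n \<ge> 1" "prime p" "p dvd n"
  \<comment> \<open>The same-primes case with \<open>m = p\<close>, whose only prime factor divides
    \<open>n\<close>.\<close>
  then show "T_poly (n * p) = smult (real p) (pcompose (T_poly n) (monom 1 p))"
    by (intro T_poly_mult_same_primes) (auto simp: prime_gt_0_nat primes_dvd_imp_eq)
next
  fix n p :: nat assume "n \<ge> 1" "prime p" "\<not> p dvd n"
  then show "T_poly (n * p) = smult (real p - 2) (pcompose (T_poly n) (monom 1 p)) +
      (\<Sum>i<p. monom 1 (i * n)) * T_poly n"
    by (intro T_poly_mult_prime) auto
qed

end
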